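(* Let $n\in\mathbb{N}$ and let $\alpha$ be a composition. The number of words $w\in\mathcal{A}_n^*$ lying in any given hypoplactic class (i.e. with $\mathrm{QR}(w)=T$ for a fixed quasi-ribbon tableau $T$) whose quasi-ribbon tableau has shape $\alpha$ is \[\sum_{\beta\preceq\alpha}(-1)^{\ell(\alpha)-\ell(\beta)}\binom{|\beta|}{\beta_1,\dots,\beta_{\ell(\beta)}}\] if $\ell(\alpha)\le n$, and is $0$ otherwise.
   Context: $\mathcal{A}_n=\{1<\dots<n\}$. A composition $\alpha=(\alpha_1,\dots,\alpha_k)$ has positive parts, length $\ell(\alpha)=k$ and weight $|\alpha|=\alpha_1+\dots+\alpha_k$. For compositions $\alpha,\beta$ of equal weight, $\beta\preceq\alpha$ ($\beta$ coarser than $\alpha$) means every partial sum $\beta_1+\dots+\beta_{p'}$ ($p'<\ell(\beta)$) equals some partial sum $\alpha_1+\dots+\alpha_{m'}$ ($m'<\ell(\alpha)$); i.e. $\beta$ arises from $\alpha$ by merging consecutive parts. $\binom{|\beta|}{\beta_1,\dots}$ is the multinomial coefficient. A ribbon diagram of shape $\alpha$ has $\alpha_h$ boxes in row $h$, the leftmost box of each row directly below the rightmost box of the previous one. A quasi-ribbon tableau is such a diagram filled with positive integers, rows weakly increasing left to right, columns strictly increasing top to bottom. Insertion of $a$ into $T$: if no entry of $T$ is $\le a$ (or $T$ empty), create a cell $a$ with $T$ attached so its first cell is directly below $a$; if no entry is $>a$, attach a new cell $a$ directly right of the last cell of $T$; otherwise let $x$ be the last cell (along the ribbon, top-left to bottom-right)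 with entry $\le a$ and $z$ the next cell, and form the part of $T$ up to $x$, a new cell $a$ directly right of $x$, and the rest of $T$ from $z$ attached with $z$ directly below the new cell. $\mathrm{QR}(w)$ for $w=a_1\cdots a_k$ is obtained by successive insertion starting from the empty tableau. The hypoplactic class of $w$ in $\mathcal{A}_n^*$ is $\{u\in\mathcal{A}_n^*:\mathrm{QR}(u)=\mathrm{QR}(w)\}$. *)

theory Defs
  imports Complex_Main
begin

section \<open>Compositions\<close>

definition composition :: "nat list \<Rightarrow> bool" where
  "composition \<alpha> \<longleftrightarrow> (\<forall>a\<in>set \<alpha>. 0 < a)"

text \<open>Both arguments are required to be compositions, of the same weight.  The partial sums
  compared are the proper ones: the total weight is excluded on both sides.\<close>

definition coarser :: "nat list \<Rightarrow> nat list \<Rightarrow> bool" (infix "\<preceq>\<^sub>c" 50) where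
  "\<beta> \<preceq>\<^sub>c \<alpha> \<longleftrightarrow> composition \<beta> \<and> composition \<alpha> \<and> sum_list \<beta> = sum_list \<alpha> \<and>
     (\<forall>p<length \<beta>. \<exists>m<length \<alpha>. sum_list (take p \<beta>) = sum_list (take m \<alpha>))"

definition multinomial :: "nat list \<Rightarrow> nat" where
  "multinomial \<beta> = fact (sum_list \<beta>) div prod_list (map fact \<beta>)"

lemma length_le_sum_list_composition: "composition \<beta> \<Longrightarrow> length \<beta> \<le> sum_list \<beta>"
  by (induction \<beta>) (auto simp: composition_def)

lemma finite_coarser: "finite {\<beta>. \<beta> \<preceq>\<^sub>c \<alpha>}"
proof (rule finite_subset)
  show "{\<beta>. \<beta> \<preceq>\<^sub>c \<alpha>} \<subseteq> {\<beta>. set \<beta> \<subseteq> {..sum_list \<alpha>} \<and> length \<beta> \<le> sum_list \<alpha>}"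
    using length_le_sum_list_composition
    by (auto simp: coarser_def dest: member_le_sum_list)
       (metis member_le_sum_list)
qed (simp add: finite_lists_length_le)

section \<open>Quasi-ribbon tableaux\<close>

text \<open>A filled ribbon diagram is the list of its nonempty rows, from top to bottom, each read from
  left to right.  Its geometry is implicit: the first cell of a row is directly below the last cell
  of the previous row, so that \<open>concat T\<close> lists the entries along the ribbon.\<close>

type_synonym ribbon = "nat list list"

definition shape :: "ribbon \<Rightarrow> nat list" where
  "shape T = map length T"

definition entries :: "ribbon \<Rightarrow> nat set" where
  "entries T = set (concat T)"

text \<open>Two cells are vertically adjacent iff they are the last cell of a row and the first cell of
  the next row, hence the last conjunct says that columns are strictly increasing.\<close>

definition quasi_ribbon_tableau :: "ribbon \<Rightarrow> bool" where
  "quasi_ribbon_tableau T \<longleftrightarrow>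
     (\<forall>r\<in>set T. r \<noteq> [] \<and> sorted r) \<and>
     (\<forall>x\<in>entries T. 0 < x) \<and>
     (\<forall>h. Suc h < length T \<longrightarrow> last (T ! h) < hd (T ! Suc h))"

section \<open>Insertion\<close>

text \<open>The first \<open>k\<close> cells of a ribbon, and the remaining ones.\<close>

fun ribbon_take :: "nat \<Rightarrow> ribbon \<Rightarrow> ribbon" where
  "ribbon_take k [] = []"
| "ribbon_take k (r # T) =
     (if k = 0 then []
      else if k \<le> length r then [take k r]
      else r # ribbon_take (k - length r) T)"

fun ribbon_drop :: "nat \<Rightarrow> ribbon \<Rightarrow> ribbon" where
  "ribbon_drop k [] = []"
| "ribbon_drop k (r # T) =
     (if k < length r then drop k r # T
      else ribbon_drop (k - length r) T)"

text \<open>Attaching a new cell directly right of the last cell of a nonempty ribbon.\<close>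

definition attach_right :: "ribbon \<Rightarrow> nat \<Rightarrow> ribbon" where
  "attach_right T a = butlast T @ [last T @ [a]]"

text \<open>In the last case, \<open>k\<close> is the number of cells up to and including the last one with entry
  at most \<open>a\<close>; appending two lists of rows puts the first cell of the second ribbon directly below
  the last cell of the first one.\<close>

definition qr_insert :: "nat \<Rightarrow> ribbon \<Rightarrow> ribbon" where
  "qr_insert a T =
     (if \<not> (\<exists>x\<in>entries T. x \<le> a) then [a] # T
      else if \<not> (\<exists>x\<in>entries T. x > a) then attach_right T a
      else let k = Suc (Max {i. i < length (concat T) \<and> concat T ! i \<le> a})
           in attach_right (ribbon_take k T) a @ ribbon_drop k T)"

definition QR :: "nat list \<Rightarrow> ribbon" where
  "QR w = foldl (\<lambda>T a. qr_insert a T) [] w"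

text \<open>The words over the alphabet \<open>1 < \<dots> < n\<close> are the elements of \<open>lists {1..n}\<close>.\<close>

definition hypoplactic_class :: "nat \<Rightarrow> nat list \<Rightarrow> nat list set" where
  "hypoplactic_class n w = {u \<in> lists {1..n}. QR u = QR w}"

end

theory Submission
  imports Defs "HOL-Library.Multiset"
begin

text \<open>
  A word \<open>w\<close> has tableau \<open>T\<close> iff it is a rearrangement of the entries of \<open>T\<close>, every row of \<open>T\<close>
  is the subword of \<open>w\<close> formed by the letters of that row, and for consecutive rows \<open>r\<close>, \<open>s\<close> some
  occurrence of the first entry of \<open>s\<close> precedes some occurrence of the last entry of \<open>r\<close>.  If the
  last condition is dropped for the first two rows \<open>r\<close>, \<open>s\<close> of \<open>T = r # s # S\<close>, the word is a
  shuffle of \<open>r\<close> with a word of tableau \<open>s # S\<close>, and its own tableau is either \<open>T\<close> or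
  \<open>(r @ s) # S\<close>.  With \<open>N(T)\<close> the number of words of tableau \<open>T\<close> and \<open>m\<close> the number of cells of \<open>T\<close>,
  this gives \<open>N(r # s # S) = (m choose length r) * N(s # S) - N((r @ s) # S)\<close>.  The signed sum
  satisfies the same recursion, because a composition coarser than \<open>a # b # \<alpha>\<close> either begins with
  \<open>a\<close> or is coarser than \<open>(a + b) # \<alpha>\<close>.
\<close>

section \<open>Ribbons with increasing rows\<close>

text \<open>The column condition in global form: it compares all entries of different rows, so it
  passes to sublists of rows and decomposes along \<open>#\<close> and append.\<close>

definition row_ordered :: "ribbon \<Rightarrow> bool" where
  "row_ordered T \<longleftrightarrow> (\<forall>r\<in>set T. r \<noteq> [] \<and> sorted r) \<and>
     sorted_wrt (\<lambda>r s. \<forall>x\<in>set r. \<forall>y\<in>set s. x < y) T"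

lemma row_ordered_Nil [simp]: "row_ordered []"
  by (simp add: row_ordered_def)

lemma row_ordered_Cons:
  "row_ordered (r # T) \<longleftrightarrow>
     r \<noteq> [] \<and> sorted r \<and> (\<forall>x\<in>set r. \<forall>y\<in>set (concat T). x < y) \<and> row_ordered T"
  by (auto simp: row_ordered_def)

lemma row_ordered_append:
  "row_ordered (S @ T) \<longleftrightarrow>
     row_ordered S \<and> row_ordered T \<and> (\<forall>x\<in>set (concat S). \<forall>y\<in>set (concat T). x < y)"
  by (induction S) (simp, simp add: row_ordered_Cons ball_Un, blast)

lemma sorted_concat_row_ordered: "row_ordered T \<Longrightarrow> sorted (concat T)"
  by (induction T) (auto simp: row_ordered_Cons sorted_append less_imp_le)

lemma hd_concat_row_ordered: "row_ordered T \<Longrightarrow> T \<noteq> [] \<Longrightarrow> hd (concat T) = hd (hd T)"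
  by (cases T) (auto simp: row_ordered_Cons)

text \<open>Rows are nonempty and pairwise disjoint, so each contributes a new letter. This yields
  the vanishing of the count when there are more rows than letters.\<close>

lemma length_le_card_entries: "row_ordered T \<Longrightarrow> length T \<le> card (entries T)"
proof (induction T)
  case (Cons r T)
  have "entries (r # T) = set r \<union> entries T" "set r \<inter> entries T = {}"
    using Cons.prems by (force simp: entries_def row_ordered_Cons)+
  moreover have "0 < card (set r)" "finite (entries T)"
    using Cons.prems by (auto simp: entries_def row_ordered_Cons card_gt_0_iff)
  ultimately show ?case
    using Cons by (simp add: card_Un_disjoint row_ordered_Cons)
qed simp

text \<open>For \<open>x\<close> in the first row and \<open>y\<close> below it,
  \<open>x \<le> last r < hd (hd T) \<le> y\<close>; the last inequality holds because the remaining
  rows, ordered by induction, concatenate to a sorted list.\<close>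

lemma row_ordered_quasi_ribbon_tableau:
  assumes "quasi_ribbon_tableau T"
  shows "row_ordered T"
proof -
  have "\<forall>h. Suc h < length T \<longrightarrow> last (T ! h) < hd (T ! Suc h)"
    and "\<forall>r\<in>set T. r \<noteq> [] \<and> sorted r"
    using assms by (auto simp: quasi_ribbon_tableau_def)
  then show ?thesis
  proof (induction T)
    case (Cons r T)
    have "\<forall>h. Suc h < length T \<longrightarrow> last (T ! h) < hd (T ! Suc h)"
      using Cons.prems(1) by (metis Suc_less_eq length_Cons nth_Cons_Suc)
    then have T: "row_ordered T"
      using Cons by simp
    have "x < y" if x: "x \<in> set r" and y: "y \<in> set (concat T)" for x y
    proof -
      have "T \<noteq> []"
        using y by auto
      then have "last r < hd (hd T)"
        using Cons.prems(1)[rule_format, of 0] by (cases T) auto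
      moreover have "x \<le> last r"
        using x Cons.prems(2) by (metis list.set_intros(1) sorted_wrt_append[of "(\<le>)" "butlast r" "[last r]"]
            append_butlast_last_id order_refl rotate1.simps(2) set_ConsD set_rotate1)
      moreover have "hd (hd T) \<le> y"
        using sorted_concat_row_ordered[OF T] y hd_concat_row_ordered[OF T \<open>T \<noteq> []\<close>]
        by (cases "concat T") auto
      ultimately show ?thesis
        by simp
    qed
    then show ?case
      using T Cons.prems(2) by (simp add: row_ordered_Cons)
  qed simp
qed

text \<open>Entries increase weakly along the ribbon, so those at most \<open>a\<close> form an
  initial segment. It ends in the row \<open>p @ q\<close>, after the nonempty part
  \<open>p\<close>; \<open>q\<close> may be empty.\<close>

lemma row_ordered_split:
  assumes "row_ordered T" "x \<in> entries T" "x \<le> a"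
  obtains U p q V where "T = U @ (p @ q) # V" "p \<noteq> []"
    "\<forall>y\<in>set (concat U @ p). y \<le> a" "\<forall>y\<in>set (q @ concat V). a < y"
proof -
  have "\<exists>U p q V. T = U @ (p @ q) # V \<and> p \<noteq> [] \<and>
      (\<forall>y\<in>set (concat U @ p). y \<le> a) \<and> (\<forall>y\<in>set (q @ concat V). a < y)"
    using assms
  proof (induction T arbitrary: x)
    case (Cons r T)
    show ?case
    proof (cases "\<exists>z\<in>entries T. z \<le> a")
      case True
      then obtain z where z: "z \<in> entries T" "z \<le> a"
        by blast
      have T: "row_ordered T"
        using Cons.prems by (simp add: row_ordered_Cons)
      obtain U p q V where *: "T = U @ (p @ q) # V" "p \<noteq> []"
        "\<forall>y\<in>set (concat U @ p). y \<le> a" "\<forall>y\<in>set (q @ concat V). a < y"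
        using Cons.IH[OF T z] by blast
      \<comment> \<open>Every entry of \<open>r\<close> is smaller than the entry \<open>z\<close>
        of a later row.\<close>
      have "\<forall>y\<in>set r. y \<le> a"
        using Cons.prems z by (fastforce simp: row_ordered_Cons entries_def)
      then have "r # T = (r # U) @ (p @ q) # V \<and> p \<noteq> [] \<and>
          (\<forall>y\<in>set (concat (r # U) @ p). y \<le> a) \<and> (\<forall>y\<in>set (q @ concat V). a < y)"
        using * by auto
      then show ?thesis
        by blast
    next
      \<comment> \<open>No later row has an entry at most \<open>a\<close>, so the cut falls inside
        \<open>r\<close> or at its end.\<close>
      case False
      define p where "p = takeWhile (\<lambda>y. y \<le> a) r"
      define q where "q = dropWhile (\<lambda>y. y \<le> a) r"
      have r: "r = p @ q" "sorted (p @ q)"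
        using Cons.prems(1) by (simp_all add: p_def q_def row_ordered_Cons)
      have p: "\<forall>y\<in>set p. y \<le> a"
        by (auto simp: p_def dest: set_takeWhileD)
      have q: "\<forall>y\<in>set q. a < y"
      proof (cases q)
        case (Cons z q')
        then have "\<not> z \<le> a"
          by (metis hd_dropWhile list.distinct(1) list.sel(1) q_def)
        then show ?thesis
          using r(2) Cons by (auto simp: sorted_append)
      qed simp
      have "x \<in> set r"
        using False Cons.prems by (auto simp: entries_def)
      then have "p \<noteq> []"
        using q r Cons.prems by (auto simp: leD)
      then have "r # T = [] @ (p @ q) # T \<and> p \<noteq> [] \<and>
          (\<forall>y\<in>set (concat [] @ p). y \<le> a) \<and> (\<forall>y\<in>set (q @ concat T). a < y)"
        using p q r False by (auto simp: entries_def not_le)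
      then show ?thesis
        by blast
    qed
  qed (simp add: entries_def)
  then show thesis
    using that by blast
qed

section \<open>Insertion into a split ribbon\<close>

lemma ribbon_take_append:
  assumes "p \<noteq> []"
  shows "ribbon_take (length (concat U @ p)) (U @ (p @ q) # V) = U @ [p]"
  using assms by (induction U) auto

text \<open>If \<open>q = []\<close>, the cut falls at the end of a row and no empty row may remain.
  The rows of \<open>V\<close> are nonempty because \<open>ribbon_drop 0\<close> would skip leading
  empty rows.\<close>

lemma ribbon_drop_append:
  assumes "\<forall>r\<in>set V. r \<noteq> []"
  shows "ribbon_drop (length (concat U @ p)) (U @ (p @ q) # V) = (if q = [] then V else q # V)"
proof (induction U)
  case Nil
  show ?case
    using assms by (cases V) auto
qed auto

text \<open>One formula for the last two branches of \<open>qr_insert\<close>: the last cell with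
  entry at most \<open>a\<close> is the last cell of \<open>p\<close>, at position
  \<open>length (concat U @ p) - 1\<close>. If nothing exceeds \<open>a\<close>, then
  \<open>q\<close> and \<open>V\<close> are empty and the formula is
  \<open>attach_right\<close>.\<close>

lemma qr_insert_split:
  assumes T: "row_ordered T" "T = U @ (p @ q) # V" and "p \<noteq> []"
    and le: "\<forall>y\<in>set (concat U @ p). y \<le> a" and gt: "\<forall>y\<in>set (q @ concat V). a < y"
  shows "qr_insert a T = U @ (p @ [a]) # (if q = [] then V else q # V)"
proof -
  have "last p \<in> entries T" "last p \<le> a"
    using assms by (auto simp: entries_def)
  then have 1: "\<exists>x\<in>entries T. x \<le> a"
    by blast
  have V: "\<forall>r\<in>set V. r \<noteq> []"
    using T by (auto simp: row_ordered_append row_ordered_Cons row_ordered_def)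
  show ?thesis
  proof (cases "\<exists>x\<in>entries T. x > a")
    case True
    have cT: "concat T = (concat U @ p) @ (q @ concat V)"
      using T by simp
    have "{i. i < length (concat T) \<and> concat T ! i \<le> a} = {..<length (concat U @ p)}"
    proof (intro set_eqI iffI; clarsimp simp only: mem_Collect_eq lessThan_iff)
      fix i assume i: "i < length (concat T)" "concat T ! i \<le> a"
      show "i < length (concat U @ p)"
      proof (rule ccontr)
        assume *: "\<not> i < length (concat U @ p)"
        have "(q @ concat V) ! (i - length (concat U @ p)) \<in> set (q @ concat V)"
          by (rule nth_mem) (use i * in \<open>simp add: cT\<close>)
        then show False
          using i(2) * gt unfolding cT nth_append[of "concat U @ p"] by (metis leD)
      qed
    next
      fix i assume i: "i < length (concat U @ p)"
      then have "(concat U @ p) ! i \<in> set (concat U @ p)"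
        by (rule nth_mem)
      then show "i < length (concat T) \<and> concat T ! i \<le> a"
        using i le unfolding cT nth_append[of "concat U @ p"] by auto
    qed
    moreover have "length (concat U @ p) = Suc (length (concat U @ p) - 1)"
      using \<open>p \<noteq> []\<close> by (simp add: Suc_leI)
    ultimately have "{i. i < length (concat T) \<and> concat T ! i \<le> a} = {..length (concat U @ p) - 1}"
      by (metis lessThan_Suc_atMost)
    then have "Max {i. i < length (concat T) \<and> concat T ! i \<le> a} = length (concat U @ p) - 1"
      by (simp only:) (rule Max_eqI, auto)
    then have "Suc (Max {i. i < length (concat T) \<and> concat T ! i \<le> a}) = length (concat U @ p)"
      using \<open>p \<noteq> []\<close> by (simp add: Suc_leI)
    moreover have "attach_right (U @ [p]) a = U @ [p @ [a]]"
      by (simp add: attach_right_def)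
    ultimately show ?thesis
      using 1 True unfolding qr_insert_def Let_def T(2)
      by (simp del: length_append add: ribbon_take_append[OF \<open>p \<noteq> []\<close>] ribbon_drop_append[OF V])
  next
    case False
    have "set (q @ concat V) = {}"
    proof (rule equals0I)
      fix y assume "y \<in> set (q @ concat V)"
      then show False
        using gt False by (auto simp: entries_def T(2))
    qed
    then have "q @ concat V = []"
      by (simp only: set_empty)
    then have "q = [] \<and> V = []"
      using V by (cases V) simp_all
    then show ?thesis
      using 1 False by (simp add: qr_insert_def attach_right_def T(2))
  qed
qed

section \<open>Words compatible with a ribbon\<close>

primrec before :: "'a list \<Rightarrow> 'a \<Rightarrow> 'a \<Rightarrow> bool" where
  "before [] z x \<longleftrightarrow> False"
| "before (y # w) z x \<longleftrightarrow> y = z \<and> x \<in> set w \<or> before w z x"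

lemma before_snoc: "before (w @ [a]) z x \<longleftrightarrow> before w z x \<or> x = a \<and> z \<in> set w"
  by (induction w) auto

lemma before_filter: "P z \<Longrightarrow> P x \<Longrightarrow> before (filter P w) z x \<longleftrightarrow> before w z x"
  by (induction w) auto

lemma before_sorted: "sorted w \<Longrightarrow> before w z x \<Longrightarrow> z \<le> x"
  by (induction w) auto

text \<open>For a row-ordered \<open>T\<close>, the last condition says that the inverse of the
  standardization of \<open>w\<close> has a descent at each row boundary, and the row condition that
  it has none inside a row.\<close>

definition compatible :: "nat list \<Rightarrow> ribbon \<Rightarrow> bool" where
  "compatible w T \<longleftrightarrow> mset w = mset (concat T) \<and>
     (\<forall>r\<in>set T. filter (\<lambda>x. x \<in> set r) w = r) \<and>
     successively (\<lambda>r s. before w (hd s) (last r)) T"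

lemma compatible_set: "compatible w T \<Longrightarrow> set w = entries T"
  unfolding compatible_def entries_def by (metis mset_eq_setD)

text \<open>Strictness comes from \<open>hd p\<close>: entries of \<open>U\<close> are below it and
  it is at most \<open>a\<close>. Hence \<open>a\<close> occurs in no row of
  \<open>U\<close>.\<close>

lemma row_ordered_split_less:
  assumes T: "row_ordered (U @ (p @ q) # V)" and "p \<noteq> []" and le: "\<forall>y\<in>set (concat U @ p). y \<le> a"
  shows "\<forall>y\<in>set (concat U). y < a"
proof
  fix y assume "y \<in> set (concat U)"
  moreover have "hd p \<in> set (concat ((p @ q) # V))"
    using \<open>p \<noteq> []\<close> by simp
  ultimately have "y < hd p"
    using T unfolding row_ordered_append by blast
  then show "y < a"
    using \<open>p \<noteq> []\<close> le by (simp add: ball_Un order.strict_trans2)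
qed

lemma row_ordered_qr_insert:
  assumes T: "row_ordered T"
  shows "row_ordered (qr_insert a T)"
proof (cases "\<exists>x\<in>entries T. x \<le> a")
  case True
  then obtain x where "x \<in> entries T" "x \<le> a"
    by blast
  from row_ordered_split[OF T this] obtain U p q V where *:
    "T = U @ (p @ q) # V" "p \<noteq> []"
    "\<forall>y\<in>set (concat U @ p). y \<le> a" "\<forall>y\<in>set (q @ concat V). a < y"
    by blast
  have "\<forall>y\<in>set (concat U). y < a"
    using row_ordered_split_less T * by metis
  then show ?thesis
    unfolding qr_insert_split[OF T *] using T *
    by (auto simp: row_ordered_append row_ordered_Cons sorted_append intro: le_less_trans)
next
  case False
  then show ?thesis
    using T by (auto simp: qr_insert_def row_ordered_Cons entries_def not_le)
qed

text \<open>The new letter is the last one of the word. It extends the subword \<open>p\<close> on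
  the right, and every letter heading the row after the new cell already stands before it.\<close>

lemma compatible_qr_insert:
  assumes T: "row_ordered T" and w: "compatible w T"
  shows "compatible (w @ [a]) (qr_insert a T)"
proof (cases "\<exists>x\<in>entries T. x \<le> a")
  case True
  then obtain x where "x \<in> entries T" "x \<le> a"
    by blast
  from row_ordered_split[OF T this] obtain U p q V where *:
    "T = U @ (p @ q) # V" "p \<noteq> []"
    "\<forall>y\<in>set (concat U @ p). y \<le> a" "\<forall>y\<in>set (q @ concat V). a < y"
    by blast
  have U: "\<forall>y\<in>set (concat U). y < a"
    using row_ordered_split_less T * by metis
  have w_set: "set w = set (concat U) \<union> set p \<union> set q \<union> set (concat V)"
    using compatible_set[OF w] *(1) by (auto simp: entries_def)
  have rows: "filter (\<lambda>x. x \<in> set r) w = r" if "r \<in> set T" for r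
    using w that by (auto simp: compatible_def)
  have pq: "filter (\<lambda>x. x \<in> set (p @ q)) w = p @ q"
    by (rule rows) (simp add: *(1))
  have disj: "set p \<inter> set q = {}"
    using *(3,4) unfolding disjoint_iff set_append by (meson UnCI leD)
  have "filter (\<lambda>x. x \<in> set p) (filter (\<lambda>x. x \<in> set (p @ q)) w) = filter (\<lambda>x. x \<in> set p) w"
    unfolding filter_filter by (rule filter_cong) auto
  moreover have "filter (\<lambda>x. x \<in> set p) (p @ q) = p"
    using disj by (auto simp: filter_id_conv filter_empty_conv)
  ultimately have p: "filter (\<lambda>x. x \<in> set p) w = p"
    unfolding pq by simp
  have "filter (\<lambda>x. x \<in> set q) (filter (\<lambda>x. x \<in> set (p @ q)) w) = filter (\<lambda>x. x \<in> set q) w"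
    unfolding filter_filter by (rule filter_cong) auto
  moreover have "filter (\<lambda>x. x \<in> set q) (p @ q) = q"
    using disj by (auto simp: filter_id_conv filter_empty_conv)
  ultimately have q: "filter (\<lambda>x. x \<in> set q) w = q"
    unfolding pq by simp
  \<comment> \<open>Entries of \<open>U\<close> are below \<open>a\<close>, those of
    \<open>q\<close> and \<open>V\<close> above it; so earlier copies of \<open>a\<close> can only
    lie in \<open>p\<close>.\<close>
  have "a \<in> set p" if "a \<in> set w"
    using that w_set U *(4) by auto
  then have "filter (\<lambda>x. x = a \<or> x \<in> set p) w = filter (\<lambda>x. x \<in> set p) w"
    by (intro filter_cong) auto
  then have pa: "filter (\<lambda>x. x \<in> set (p @ [a])) (w @ [a]) = p @ [a]"
    using p by simp
  have row: "filter (\<lambda>x. x \<in> set r) (w @ [a]) = r"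
    if r: "r \<in> set (U @ (p @ [a]) # (if q = [] then V else q # V))" for r
  proof -
    consider "r \<in> set U" | "r = p @ [a]" | "r = q" "q \<noteq> []" | "r \<in> set V"
      using r by (auto split: if_splits)
    then show ?thesis
    proof cases
      case 1
      then have "a \<notin> set r" using U by auto
      then show ?thesis using rows[of r] 1 *(1) by simp
    next
      case 3
      then have "a \<notin> set r" using *(4) by auto
      then show ?thesis using q 3 by simp
    next
      case 4
      then have "a \<notin> set r" using *(4) by auto
      then show ?thesis using rows[of r] 4 *(1) by simp
    qed (use pa in simp)
  qed
  have V: "hd (hd V) \<in> set w" if "V \<noteq> []"
  proof -
    have "hd V \<noteq> []"
      using that T *(1) by (cases V) (auto simp: row_ordered_append row_ordered_Cons)
    then have "hd (hd V) \<in> set (concat V)"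
      using that by (cases V) auto
    then show ?thesis
      by (simp add: w_set)
  qed
  have hd_q: "hd q \<in> set w" if "q \<noteq> []"
    using that by (simp add: w_set)
  have succ: "successively (\<lambda>r s. before w (hd s) (last r)) (U @ (p @ q) # V)"
    using w *(1) by (simp add: compatible_def)
  have "successively (\<lambda>r s. before (w @ [a]) (hd s) (last r)) (U @ (p @ q) # V)"
    by (rule successively_mono[OF succ]) (simp add: before_snoc)
  \<comment> \<open>Since \<open>p\<close> is nonempty, the changed row keeps its head, so the
    boundary above it is unaffected. The boundary below it now has \<open>a\<close> as its upper
    entry, and \<open>before_snoc\<close> settles it because the next head occurs in
    \<open>w\<close>.\<close>
  then have "successively (\<lambda>r s. before (w @ [a]) (hd s) (last r))
      (U @ (p @ [a]) # (if q = [] then V else q # V))"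
    using V hd_q *(2) by (auto simp: successively_append_iff successively_Cons before_snoc)
  then show ?thesis
    unfolding qr_insert_split[OF T *] compatible_def
    using row w *(1) by (auto simp: compatible_def)
next
  case False
  then have a: "\<forall>y\<in>set (concat T). a < y" and ins: "qr_insert a T = [a] # T"
    by (auto simp: qr_insert_def entries_def not_le)
  have w_set: "set w = set (concat T)"
    using compatible_set[OF w] by (simp add: entries_def)
  have "a \<notin> set w" "\<forall>r\<in>set T. a \<notin> set r"
    using a unfolding w_set by auto
  moreover have "hd (hd T) \<in> set w" if "T \<noteq> []"
    using that T w_set by (cases T) (auto simp: row_ordered_Cons)
  moreover have "successively (\<lambda>r s. before (w @ [a]) (hd s) (last r)) T"
    by (rule successively_mono[of "\<lambda>r s. before w (hd s) (last r)"])
      (use w in \<open>auto simp: compatible_def before_snoc\<close>)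
  ultimately show ?thesis
    using w unfolding ins compatible_def
    by (auto simp: successively_Cons before_snoc filter_empty_conv)
qed

section \<open>The insertion tableau as the unique compatible ribbon\<close>

lemma QR_snoc: "QR (w @ [a]) = qr_insert a (QR w)"
  by (simp add: QR_def)

lemma row_ordered_QR: "row_ordered (QR w)"
  by (induction w rule: rev_induct) (simp_all add: QR_snoc row_ordered_qr_insert, simp add: QR_def)

lemma compatible_QR: "compatible w (QR w)"
  by (induction w rule: rev_induct)
    (simp_all add: QR_snoc row_ordered_QR compatible_qr_insert, simp add: QR_def compatible_def)

text \<open>If \<open>us\<close> were nonempty, its head would also head the row below
  \<open>r\<close>, so it would precede some \<open>last r\<close> in \<open>w\<close>. Both letters
  lie in the sorted subword \<open>r'\<close>, giving \<open>hd us \<le> last r\<close>, against the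
  strict increase from \<open>r\<close> to the next row.\<close>

lemma row_not_prefix:
  assumes T: "row_ordered (r # T)" and T': "row_ordered (r' # T')"
    and suc: "successively (\<lambda>r s. before w (hd s) (last r)) (r # T)"
    and row: "filter (\<lambda>x. x \<in> set r') w = r'"
    and eq: "r' = r @ us" "us @ concat T' = concat T"
  shows "us = []"
proof (rule ccontr)
  assume us: "us \<noteq> []"
  then have "T \<noteq> []"
    using eq(2) by auto
  then have "hd (hd T) = hd us"
    using eq(2) us T by (metis hd_append2 hd_concat_row_ordered row_ordered_Cons)
  then have "before w (hd us) (last r)"
    using suc \<open>T \<noteq> []\<close> by (auto simp: successively_Cons)
  then have "before (filter (\<lambda>x. x \<in> set r') w) (hd us) (last r)"
    using us T eq(1) by (subst before_filter) (auto simp: row_ordered_Cons)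
  then have "hd us \<le> last r"
    using T' by (auto simp: row row_ordered_Cons intro: before_sorted)
  moreover have "hd us \<in> set (concat T)"
    using us unfolding eq(2)[symmetric] by simp
  then have "last r < hd us"
    using T last_in_set unfolding row_ordered_Cons by blast
  ultimately show False
    by simp
qed

text \<open>The entries along the ribbon are \<open>sort w\<close> in both cases, so of the two
  first rows one is a prefix of the other; \<open>row_not_prefix\<close> makes them equal, and the
  argument repeats on the remaining rows.\<close>

lemma compatible_unique:
  assumes "row_ordered T" "row_ordered T'" "compatible w T" "compatible w T'"
  shows "T = T'"
proof -
  have "sort w = concat S" if "row_ordered S" "compatible w S" for S
    using that by (simp add: compatible_def properties_for_sort sorted_concat_row_ordered)
  then have "concat T = concat T'"
    using assms by metis
  moreover have "\<forall>r\<in>set T. filter (\<lambda>x. x \<in> set r) w = r" "\<forall>r\<in>set T'. filter (\<lambda>x. x \<in> set r) w = r"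
    "successively (\<lambda>r s. before w (hd s) (last r)) T"
    "successively (\<lambda>r s. before w (hd s) (last r)) T'"
    using assms by (simp_all add: compatible_def)
  ultimately show ?thesis
    using assms(1,2)
  proof (induction T arbitrary: T')
    case Nil
    then show ?case by (cases T') (auto simp: row_ordered_Cons)
  next
    case (Cons r T R)
    then obtain r' T' where R: "R = r' # T'"
      by (cases R) (auto simp: row_ordered_Cons)
    from Cons.prems(1) have "r @ concat T = r' @ concat T'"
      by (simp add: R)
    then obtain us where "r = r' @ us \<and> us @ concat T = concat T' \<or>
        r @ us = r' \<and> concat T = us @ concat T'"
      by (auto simp: append_eq_append_conv2)
    then have "r = r' \<and> concat T = concat T'"
    proof (elim disjE conjE)
      assume *: "r = r' @ us" "us @ concat T = concat T'"
      then have "us = []"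
        using row_not_prefix[of r' T' r T w us] Cons.prems by (simp add: R)
      then show ?thesis using * by simp
    next
      assume *: "r @ us = r'" "concat T = us @ concat T'"
      moreover have "filter (\<lambda>x. x \<in> set r') w = r'"
        using Cons.prems(3) by (simp only: R list.set ball_simps)
      ultimately have "us = []"
        using row_not_prefix[OF Cons.prems(6) Cons.prems(7)[unfolded R] Cons.prems(4)] by metis
      then show ?thesis using * by simp
    qed
    moreover have "T = T'"
    proof (rule Cons.IH)
      show "concat T = concat T'"
        using calculation by blast
      show "\<forall>r\<in>set T. filter (\<lambda>x. x \<in> set r) w = r" "\<forall>r\<in>set T'. filter (\<lambda>x. x \<in> set r) w = r"
        using Cons.prems(2,3) unfolding R list.set by blast+
      show "successively (\<lambda>r s. before w (hd s) (last r)) T"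
        "successively (\<lambda>r s. before w (hd s) (last r)) T'"
        using Cons.prems(4,5) unfolding R successively_Cons by auto
      show "row_ordered T" "row_ordered T'"
        using Cons.prems(6,7) unfolding R row_ordered_Cons by blast+
    qed
    ultimately show ?case
      by (simp add: R)
  qed
qed

lemma QR_eq_iff: "row_ordered T \<Longrightarrow> QR w = T \<longleftrightarrow> compatible w T"
  using compatible_QR compatible_unique row_ordered_QR by blast

section \<open>Merging two rows\<close>

text \<open>The letters of \<open>r\<close> and of \<open>s\<close> each appear in order, so they
  are interleaved properly iff the first letter of \<open>s\<close> comes before the last letter of
  \<open>r\<close>.\<close>

lemma filter_Un_eq_append_iff:
  assumes r: "filter (\<lambda>x. x \<in> set r) w = r" and s: "filter (\<lambda>x. x \<in> set s) w = s"
    and ne: "r \<noteq> []" "s \<noteq> []" and sorted: "sorted (r @ s)" and disj: "set r \<inter> set s = {}"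
  shows "filter (\<lambda>x. x \<in> set (r @ s)) w = r @ s \<longleftrightarrow> \<not> before w (hd s) (last r)"
proof -
  define w' where "w' = filter (\<lambda>x. x \<in> set (r @ s)) w"
  have r': "filter (\<lambda>x. x \<in> set r) w' = r" and s': "filter (\<lambda>x. x \<in> set s) w' = s"
  proof -
    have "filter (\<lambda>x. x \<in> set r) w' = filter (\<lambda>x. x \<in> set r) w"
      "filter (\<lambda>x. x \<in> set s) w' = filter (\<lambda>x. x \<in> set s) w"
      unfolding w'_def filter_filter by (rule filter_cong; auto)+
    then show "filter (\<lambda>x. x \<in> set r) w' = r" "filter (\<lambda>x. x \<in> set s) w' = s"
      using r s by metis+
  qed
  have w': "set w' \<subseteq> set r \<union> set s"
    by (auto simp: w'_def)
  have before: "before w' (hd s) (last r) \<longleftrightarrow> before w (hd s) (last r)"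
    using ne by (auto simp: w'_def before_filter)
  have "w' = r @ s" if nb: "\<not> before w' (hd s) (last r)"
  proof -
    \<comment> \<open>The letter \<open>y\<close> following \<open>u\<close> is the first one from
      \<open>s\<close>, hence \<open>hd s\<close>. As \<open>last r\<close> cannot come after it,
      \<open>u\<close> must be all of \<open>r\<close>.\<close>
    define u where "u = takeWhile (\<lambda>x. x \<in> set r) w'"
    define v where "v = dropWhile (\<lambda>x. x \<in> set r) w'"
    have uv: "w' = u @ v"
      by (simp add: u_def v_def)
    have u: "set u \<subseteq> set r"
      by (auto simp: u_def dest: set_takeWhileD)
    have us: "filter (\<lambda>x. x \<in> set s) u = []"
      using u disj by (auto simp: filter_empty_conv)
    have ur: "filter (\<lambda>x. x \<in> set r) u = u"
      using u by (auto simp: filter_id_conv)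
    obtain y v' where v: "v = y # v'"
      using s' ne us uv by (cases v) auto
    have "y \<notin> set r"
      using v by (metis hd_dropWhile list.distinct(1) list.sel(1) v_def)
    then have "y \<in> set s"
      using w' by (auto simp: uv v)
    then have "hd s = y"
      using s' us by (metis filter.simps(2) filter_append append_Nil list.sel(1) uv v)
    then have "last r \<notin> set v'"
      using nb unfolding uv v by (induction u) auto
    moreover have r_eq: "r = u @ filter (\<lambda>x. x \<in> set r) v'"
      using r' ur \<open>y \<notin> set r\<close> by (simp add: uv v)
    ultimately have "filter (\<lambda>x. x \<in> set r) v' = []"
      by (metis filter_is_subset in_mono last_appendR last_in_set)
    then have "u = r" and "\<forall>x\<in>set v. x \<notin> set r"
      using r_eq \<open>y \<notin> set r\<close> by (auto simp: filter_empty_conv v)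
    then have "filter (\<lambda>x. x \<in> set s) v = v"
      using w' by (auto simp: filter_id_conv uv)
    then show ?thesis
      using s' us \<open>u = r\<close> by (simp add: uv)
  qed
  moreover have "\<not> before w' (hd s) (last r)" if "w' = r @ s"
  proof
    assume "before w' (hd s) (last r)"
    then have "hd s \<le> last r"
      using before_sorted sorted that by metis
    moreover have "last r \<le> hd s" "last r \<noteq> hd s"
      using sorted ne disj by (auto simp: sorted_append) (metis disjoint_iff hd_in_set last_in_set)
    ultimately show False by simp
  qed
  ultimately show ?thesis
    using before by (auto simp: w'_def)
qed

text \<open>Both conditions look only at letters of \<open>T\<close>, so deleting other letters from
  the word does not affect them.\<close>

lemma compatible_cong_filter:
  assumes "row_ordered T" "\<forall>x\<in>set (concat T). P x"
  shows "(\<forall>r\<in>set T. filter (\<lambda>x. x \<in> set r) (filter P w) = r) \<and>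
           successively (\<lambda>r s. before (filter P w) (hd s) (last r)) T \<longleftrightarrow>
         (\<forall>r\<in>set T. filter (\<lambda>x. x \<in> set r) w = r) \<and>
           successively (\<lambda>r s. before w (hd s) (last r)) T"
proof -
  have "filter (\<lambda>x. x \<in> set r) (filter P w) = filter (\<lambda>x. x \<in> set r) w" if "r \<in> set T" for r
    unfolding filter_filter using that assms(2) by (intro filter_cong) auto
  moreover have "before (filter P w) (hd s) (last r) = before w (hd s) (last r)"
    if "r \<in> set T" "s \<in> set T" for r s
  proof (rule before_filter)
    have "r \<noteq> []" "s \<noteq> []"
      using that assms(1) by (auto simp: row_ordered_def)
    then show "P (hd s)" "P (last r)"
      using that assms(2) by auto
  qed
  then have "successively (\<lambda>r s. before (filter P w) (hd s) (last r)) T \<longleftrightarrow>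
      successively (\<lambda>r s. before w (hd s) (last r)) T"
    by (intro successively_cong) auto
  ultimately show ?thesis
    by metis
qed

lemma row_ordered_merge: "row_ordered (r # s # T) \<Longrightarrow> row_ordered ((r @ s) # T)"
  by (auto simp: row_ordered_Cons sorted_append less_imp_le)

text \<open>The right-hand side imposes all conditions for \<open>r # s # T\<close> except the one
  at the boundary between \<open>r\<close> and \<open>s\<close>. Where that one fails,
  \<open>filter_Un_eq_append_iff\<close> turns \<open>r @ s\<close> into a single row, so the two
  alternatives are complementary.\<close>

lemma compatible_merge_iff:
  assumes T: "row_ordered (r # s # T)"
  shows "compatible w (r # s # T) \<or> compatible w ((r @ s) # T) \<longleftrightarrow>
           filter (\<lambda>x. x \<in> set r) w = r \<and> compatible (filter (\<lambda>x. x \<notin> set r) w) (s # T)"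
    and "\<not> (compatible w (r # s # T) \<and> compatible w ((r @ s) # T))"
proof -
  have ne: "r \<noteq> []" "s \<noteq> []" and disj: "set r \<inter> set s = {}" and sorted: "sorted (r @ s)"
  proof -
    have "\<forall>x\<in>set r. \<forall>y\<in>set s. x < y" "r \<noteq> []" "s \<noteq> []" "sorted r" "sorted s"
      using T by (simp_all add: row_ordered_Cons)
    then show "r \<noteq> []" "s \<noteq> []" "set r \<inter> set s = {}" "sorted (r @ s)"
      by (auto simp: sorted_append less_imp_le)
  qed
  have F: "(\<forall>t\<in>set (s # T). filter (\<lambda>x. x \<in> set t) (filter (\<lambda>x. x \<notin> set r) w) = t) \<and>
           successively (\<lambda>t u. before (filter (\<lambda>x. x \<notin> set r) w) (hd u) (last t)) (s # T) \<longleftrightarrow>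
         (\<forall>t\<in>set (s # T). filter (\<lambda>x. x \<in> set t) w = t) \<and>
           successively (\<lambda>r s. before w (hd s) (last r)) (s # T)" for w :: "nat list"
  proof (rule compatible_cong_filter)
    show "row_ordered (s # T)"
      using T unfolding row_ordered_Cons by blast
    show "\<forall>x\<in>set (concat (s # T)). x \<notin> set r"
      using T less_irrefl unfolding row_ordered_Cons[of r] by blast
  qed
  \<comment> \<open>The instance \<open>ball[of r]\<close> peels off the row \<open>r\<close> alone
    and leaves the quantifier over \<open>s # T\<close> in the form used by
    \<open>F\<close>.\<close>
  have ball: "(\<forall>t\<in>set (t' # U). Q t) \<longleftrightarrow> Q t' \<and> (\<forall>t\<in>set U. Q t)" for Q :: "nat list \<Rightarrow> bool" and t' U
    by simp
  have m: "mset w = mset (concat (r # s # T)) \<longleftrightarrow>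
      mset (filter (\<lambda>x. x \<notin> set r) w) = mset (concat (s # T))"
    if "filter (\<lambda>x. x \<in> set r) w = r"
  proof -
    have "mset w = mset (filter (\<lambda>x. x \<in> set r) w) + mset (filter (\<lambda>x. x \<notin> set r) w)"
      unfolding mset_filter by (rule multiset_partition)
    also have "\<dots> = mset r + mset (filter (\<lambda>x. x \<notin> set r) w)"
      unfolding that ..
    finally show ?thesis
      unfolding concat.simps(2)[of r] mset_append by (simp only: add_left_cancel)
  qed
  have rhs: "filter (\<lambda>x. x \<in> set r) w = r \<and> compatible (filter (\<lambda>x. x \<notin> set r) w) (s # T) \<longleftrightarrow>
      mset w = mset (concat (r # s # T)) \<and> (\<forall>t\<in>set (r # s # T). filter (\<lambda>x. x \<in> set t) w = t) \<and>
      successively (\<lambda>r s. before w (hd s) (last r)) (s # T)"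
    unfolding compatible_def ball[of r] using F[of w] m by blast
  have split: "filter (\<lambda>x. x \<in> set r) w = r \<and> filter (\<lambda>x. x \<in> set s) w = s"
    if "filter (\<lambda>x. x \<in> set (r @ s)) w = r @ s"
  proof -
    have "filter (\<lambda>x. x \<in> set r) w = filter (\<lambda>x. x \<in> set r) (filter (\<lambda>x. x \<in> set (r @ s)) w)"
      "filter (\<lambda>x. x \<in> set s) w = filter (\<lambda>x. x \<in> set s) (filter (\<lambda>x. x \<in> set (r @ s)) w)"
      unfolding filter_filter by (rule filter_cong; auto)+
    moreover have "filter (\<lambda>x. x \<in> set r) (r @ s) = r" "filter (\<lambda>x. x \<in> set s) (r @ s) = s"
      using disj by (auto simp: filter_empty_conv filter_id_conv)
    ultimately show ?thesis
      using that by metis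
  qed
  have merge: "last (r @ s) = last s" "concat ((r @ s) # T) = concat (r # s # T)"
    using ne by simp_all
  have "compatible w ((r @ s) # T) \<longleftrightarrow>
      mset w = mset (concat (r # s # T)) \<and> (\<forall>t\<in>set (r # s # T). filter (\<lambda>x. x \<in> set t) w = t) \<and>
      successively (\<lambda>r s. before w (hd s) (last r)) (s # T) \<and> \<not> before w (hd s) (last r)"
    unfolding compatible_def merge ball successively_Cons
    using split filter_Un_eq_append_iff[OF _ _ ne sorted disj, of w] by blast
  moreover have "compatible w (r # s # T) \<longleftrightarrow>
      mset w = mset (concat (r # s # T)) \<and> (\<forall>t\<in>set (r # s # T). filter (\<lambda>x. x \<in> set t) w = t) \<and>
      successively (\<lambda>r s. before w (hd s) (last r)) (s # T) \<and> before w (hd s) (last r)"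
    unfolding compatible_def successively.simps(3) by blast
  ultimately show "compatible w (r # s # T) \<or> compatible w ((r @ s) # T) \<longleftrightarrow>
           filter (\<lambda>x. x \<in> set r) w = r \<and> compatible (filter (\<lambda>x. x \<notin> set r) w) (s # T)"
    and "\<not> (compatible w (r # s # T) \<and> compatible w ((r @ s) # T))"
    using rhs by blast+
qed

section \<open>Counting the words compatible with a ribbon\<close>

lemma finite_compatible: "finite {w. compatible w T}"
  by (rule finite_subset[of _ "{w. mset w = mset (concat T)}"]) (auto simp only: compatible_def mset_eq_finite)

lemma length_compatible: "compatible w T \<Longrightarrow> length w = sum_list (shape T)"
  by (auto simp: compatible_def shape_def length_concat dest: mset_eq_length)

text \<open>By \<open>compatible_merge_iff\<close> the words counted on the left are the shuffles of
  \<open>r\<close> with words \<open>v\<close> compatible with \<open>s # T\<close>. The letters of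
  \<open>r\<close> and \<open>v\<close> are disjoint, so each \<open>v\<close> has a binomial number
  of shuffles.\<close>

lemma card_compatible_merge:
  assumes T: "row_ordered (r # s # T)"
  shows "card {w. compatible w (r # s # T)} + card {w. compatible w ((r @ s) # T)} =
    (sum_list (shape (r # s # T)) choose length r) * card {w. compatible w (s # T)}"
proof -
  have disj: "set r \<inter> set v = {}" if "compatible v (s # T)" for v
    using compatible_set[OF that] T less_irrefl
    unfolding entries_def row_ordered_Cons[of r] disjoint_iff by blast
  have "filter (\<lambda>x. x \<in> set r) w = r \<and> compatible (filter (\<lambda>x. x \<notin> set r) w) (s # T) \<longleftrightarrow>
      (\<exists>v. compatible v (s # T) \<and> w \<in> shuffles r v)" for w
    using partition_in_shuffles[of w "\<lambda>x. x \<in> set r"] disj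
      filter_shuffles_disjoint1[of r _ w] by metis
  then have U: "{w. compatible w (r # s # T)} \<union> {w. compatible w ((r @ s) # T)} =
      (\<Union>v\<in>{v. compatible v (s # T)}. shuffles r v)"
    using compatible_merge_iff(1)[OF T] by blast
  have "card {w. compatible w (r # s # T)} + card {w. compatible w ((r @ s) # T)} =
      card (\<Union>v\<in>{v. compatible v (s # T)}. shuffles r v)"
    unfolding U[symmetric] using compatible_merge_iff(2)[OF T]
    by (intro card_Un_disjoint[symmetric] finite_compatible) auto
  also have "\<dots> = (\<Sum>v | compatible v (s # T). card (shuffles r v))"
  \<comment> \<open>Deleting the letters of \<open>r\<close> from a shuffle recovers
    \<open>v\<close>, so different \<open>v\<close> share no shuffle.\<close>
  proof (intro card_UN_disjoint finite_compatible ballI impI)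
    fix u v assume "u \<in> {v. compatible v (s # T)}" "v \<in> {v. compatible v (s # T)}" "u \<noteq> v"
    then show "shuffles r u \<inter> shuffles r v = {}"
      using filter_shuffles_disjoint1(2)[OF disj[of u]] filter_shuffles_disjoint1(2)[OF disj[of v]]
      by auto
  qed simp
  also have "\<dots> = (\<Sum>v | compatible v (s # T). sum_list (shape (r # s # T)) choose length r)"
    using disj by (intro sum.cong) (auto simp: card_disjoint_shuffles length_compatible shape_def)
  finally show ?thesis
    by simp
qed

lemma compatible_single: "compatible w [r] \<longleftrightarrow> w = r"
proof
  assume "compatible w [r]"
  then have "set w = set r" "filter (\<lambda>x. x \<in> set r) w = r"
    by (auto simp: compatible_def dest: mset_eq_setD)
  then show "w = r"
    by (metis filter_True)
qed (simp add: compatible_def)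

section \<open>The alternating sum of multinomial coefficients\<close>

text \<open>Contains 0 for nonempty lists, and for compositions never the total; with this
  convention \<open>\<preceq>\<^sub>c\<close> becomes set inclusion.\<close>

definition partial_sums :: "nat list \<Rightarrow> nat set" where
  "partial_sums \<gamma> = {sum_list (take p \<gamma>) |p. p < length \<gamma>}"

lemma partial_sums_Nil [simp]: "partial_sums [] = {}"
  by (simp add: partial_sums_def)

lemma partial_sums_Cons [simp]: "partial_sums (a # \<gamma>) = insert 0 ((+) a ` partial_sums \<gamma>)"
proof (rule set_eqI)
  fix x
  have "x \<in> partial_sums (a # \<gamma>) \<longleftrightarrow> (\<exists>p<Suc (length \<gamma>). x = sum_list (take p (a # \<gamma>)))"
    by (auto simp: partial_sums_def)
  also have "\<dots> \<longleftrightarrow> x = 0 \<or> (\<exists>p<length \<gamma>. x = a + sum_list (take p \<gamma>))"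
    by (simp add: Ex_less_Suc2)
  also have "\<dots> \<longleftrightarrow> x \<in> insert 0 ((+) a ` partial_sums \<gamma>)"
    by (auto simp: partial_sums_def)
  finally show "x \<in> partial_sums (a # \<gamma>) \<longleftrightarrow> x \<in> insert 0 ((+) a ` partial_sums \<gamma>)" .
qed

lemma coarser_iff:
  "\<beta> \<preceq>\<^sub>c \<alpha> \<longleftrightarrow> composition \<beta> \<and> composition \<alpha> \<and> sum_list \<beta> = sum_list \<alpha> \<and>
     partial_sums \<beta> \<subseteq> partial_sums \<alpha>"
  by (auto simp: coarser_def partial_sums_def)

section \<open>Recursive description of the coarser compositions\<close>

lemma composition_Cons [simp]: "composition (a # \<gamma>) \<longleftrightarrow> 0 < a \<and> composition \<gamma>"
  by (auto simp: composition_def)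

lemma coarser_Nil: "{\<beta>. \<beta> \<preceq>\<^sub>c []} = {[]}"
proof -
  have "\<beta> = []" if "composition \<beta>" "sum_list \<beta> = 0" for \<beta>
    using that by (cases \<beta>) auto
  then show ?thesis
    by (auto simp: coarser_iff composition_def)
qed

lemma coarser_single:
  assumes "0 < a"
  shows "{\<beta>. \<beta> \<preceq>\<^sub>c [a]} = {[a]}"
proof -
  have "\<beta> = [a]" if \<beta>: "\<beta> \<preceq>\<^sub>c [a]" for \<beta>
  proof (cases \<beta>)
    case (Cons c \<gamma>)
    then show ?thesis
      using \<beta> by (cases \<gamma>) (auto simp: coarser_iff)
  qed (use \<beta> assms in \<open>auto simp: coarser_iff\<close>)
  then show ?thesis
    using assms by (auto simp: coarser_iff composition_def)
qed

text \<open>Merging \<open>a\<close> and \<open>b\<close> removes exactly \<open>a\<close> from the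
  partial sums. The two sets thus separate the \<open>\<beta>\<close> having \<open>a\<close> as a
  partial sum from the others.\<close>

lemma coarser_Cons_Cons:
  assumes "0 < a" "0 < b"
  shows "{\<beta>. \<beta> \<preceq>\<^sub>c a # b # \<alpha>} = (#) a ` {\<beta>. \<beta> \<preceq>\<^sub>c b # \<alpha>} \<union> {\<beta>. \<beta> \<preceq>\<^sub>c (a + b) # \<alpha>}"
    and "(#) a ` {\<beta>. \<beta> \<preceq>\<^sub>c b # \<alpha>} \<inter> {\<beta>. \<beta> \<preceq>\<^sub>c (a + b) # \<alpha>} = {}"
proof -
  have ps: "partial_sums (a # b # \<alpha>) = insert a (partial_sums ((a + b) # \<alpha>))"
    by (simp add: image_image add.assoc insert_commute)
  have a_notin: "a \<notin> partial_sums ((a + b) # \<alpha>)"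
    using assms by auto
  have a_le: "a \<le> x" if "x \<in> partial_sums (a # b # \<alpha>)" "x \<noteq> 0" for x
    using that by auto
  have 1: "\<beta> \<in> (#) a ` {\<beta>. \<beta> \<preceq>\<^sub>c b # \<alpha>}" if \<beta>: "\<beta> \<preceq>\<^sub>c a # b # \<alpha>" and a: "a \<in> partial_sums \<beta>" for \<beta>
  proof -
    obtain c \<gamma> where \<beta>_eq: "\<beta> = c # \<gamma>"
      using a by (cases \<beta>) auto
    have "c \<le> a" and "\<gamma> \<noteq> []"
      using a assms by (auto simp: \<beta>_eq)
    \<comment> \<open>The first part \<open>c\<close> is the least nonzero partial sum of
      \<open>\<beta>\<close>, and \<open>a\<close> is that of \<open>a # b # \<alpha>\<close>; each
      bounds the other.\<close>
    then have "c \<in> partial_sums \<beta>"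
      by (cases \<gamma>) (auto simp: \<beta>_eq)
    moreover have "0 < c"
      using \<beta> by (simp add: \<beta>_eq coarser_iff)
    ultimately have "a \<le> c"
      using \<beta> by (intro a_le) (auto simp: coarser_iff)
    with \<open>c \<le> a\<close> have [simp]: "c = a"
      by simp
    \<comment> \<open>The extra element 0 can be discarded since \<open>0 < a\<close> keeps it out
      of both images.\<close>
    have "(+) a ` partial_sums \<gamma> \<subseteq> (+) a ` partial_sums (b # \<alpha>)"
      using \<beta> assms unfolding coarser_iff \<beta>_eq partial_sums_Cons[of a] partial_sums_Cons[of c] by auto
    then have "partial_sums \<gamma> \<subseteq> partial_sums (b # \<alpha>)"
      by (metis inj_image_subset_iff inj_on_add)
    then show ?thesis
      using \<beta> by (auto simp: \<beta>_eq coarser_iff)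
  qed
  have 2: "a # \<gamma> \<preceq>\<^sub>c a # b # \<alpha>" "a \<in> partial_sums (a # \<gamma>)" if "\<gamma> \<preceq>\<^sub>c b # \<alpha>" for \<gamma>
    using that assms by (cases \<gamma>; auto simp: coarser_iff)+
  have 3: "\<beta> \<preceq>\<^sub>c (a + b) # \<alpha> \<longleftrightarrow> \<beta> \<preceq>\<^sub>c a # b # \<alpha> \<and> a \<notin> partial_sums \<beta>" for \<beta>
    using a_notin assms unfolding coarser_iff ps by auto
  show "{\<beta>. \<beta> \<preceq>\<^sub>c a # b # \<alpha>} = (#) a ` {\<beta>. \<beta> \<preceq>\<^sub>c b # \<alpha>} \<union> {\<beta>. \<beta> \<preceq>\<^sub>c (a + b) # \<alpha>}"
    using 1 2 3 by blast
  show "(#) a ` {\<beta>. \<beta> \<preceq>\<^sub>c b # \<alpha>} \<inter> {\<beta>. \<beta> \<preceq>\<^sub>c (a + b) # \<alpha>} = {}"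
    using 2 3 by blast
qed

text \<open>Guarantees that the natural subtraction in the exponent of the sign does not
  truncate.\<close>

lemma length_le_coarser: "\<beta> \<preceq>\<^sub>c \<alpha> \<Longrightarrow> length \<beta> \<le> length \<alpha>"
proof (induction "length \<alpha>" arbitrary: \<alpha> \<beta>)
  case 0
  then show ?case
    using coarser_Nil by auto
next
  case (Suc m)
  then have "composition \<alpha>"
    by (simp add: coarser_iff)
  show ?case
  proof (cases "m = 0")
    case True
    with Suc obtain a where "\<alpha> = [a]"
      by (metis length_0_conv length_Suc_conv)
    then have "\<beta> \<in> {\<beta>. \<beta> \<preceq>\<^sub>c [a]}" "0 < a"
      using Suc.prems \<open>composition \<alpha>\<close> by simp_all
    then have "\<beta> = [a]"
      unfolding coarser_single[OF \<open>0 < a\<close>] by simp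
    then show ?thesis
      using \<open>\<alpha> = [a]\<close> by simp
  next
    case False
    with Suc obtain a b \<gamma> where \<alpha>: "\<alpha> = a # b # \<gamma>"
      by (metis length_0_conv length_Suc_conv list.exhaust)
    then have "\<beta> \<in> (#) a ` {\<beta>. \<beta> \<preceq>\<^sub>c b # \<gamma>} \<union> {\<beta>. \<beta> \<preceq>\<^sub>c (a + b) # \<gamma>}"
      using coarser_Cons_Cons(1)[of a b \<gamma>] Suc.prems \<open>composition \<alpha>\<close> by auto
    then show ?thesis
      using Suc.hyps(1)[of "b # \<gamma>"] Suc.hyps(1)[of "(a + b) # \<gamma>"] Suc.hyps(2) by (force simp: \<alpha>)
  qed
qed

text \<open>The \<open>div\<close> in the definition is exact, by repeated use of the divisibility
  of \<open>fact (a + b)\<close> by \<open>fact a * fact b\<close>.\<close>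

lemma multinomial_mult: "multinomial \<beta> * prod_list (map fact \<beta>) = fact (sum_list \<beta>)"
proof -
  have "prod_list (map fact \<beta>) dvd (fact (sum_list \<beta>) :: nat)"
  proof (induction \<beta>)
    case (Cons a \<beta>)
    then have "fact a * prod_list (map fact \<beta>) dvd fact a * (fact (sum_list \<beta>) :: nat)"
      by simp
    also have "\<dots> dvd fact (sum_list (a # \<beta>))"
      using fact_fact_dvd_fact[of a "sum_list \<beta>"] by simp
    finally show ?case
      by simp
  qed simp
  then show ?thesis
    by (simp add: multinomial_def)
qed

lemma multinomial_Cons: "multinomial (a # \<beta>) = (sum_list (a # \<beta>) choose a) * multinomial \<beta>"
proof -
  have "multinomial (a # \<beta>) * prod_list (map fact (a # \<beta>)) = fact a * fact (sum_list \<beta>) * (sum_list (a # \<beta>) choose a)"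
    using binomial_fact_lemma[of a "sum_list (a # \<beta>)"] by (simp only: multinomial_mult) simp
  also have "\<dots> = (sum_list (a # \<beta>) choose a) * multinomial \<beta> * prod_list (map fact (a # \<beta>))"
    by (simp flip: multinomial_mult)
  finally have "multinomial (a # \<beta>) * prod_list (map fact (a # \<beta>)) =
      (sum_list (a # \<beta>) choose a) * multinomial \<beta> * prod_list (map fact (a # \<beta>))" .
  moreover have "prod_list (map fact \<gamma>) \<noteq> (0 :: nat)" for \<gamma> :: "nat list"
    by (induction \<gamma>) auto
  ultimately show ?thesis
    by (metis mult_right_cancel)
qed

text \<open>For a composition, the inclusion-exclusion formula for the number of permutations with
  descent composition \<open>\<alpha>\<close>.\<close>

definition alternating_multinomial_sum :: "nat list \<Rightarrow> int" where
  "alternating_multinomial_sum \<alpha> =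
     (\<Sum>\<beta> | \<beta> \<preceq>\<^sub>c \<alpha>. (-1) ^ (length \<alpha> - length \<beta>) * int (multinomial \<beta>))"

text \<open>Prepending \<open>a\<close> to both compositions keeps the sign and multiplies the
  multinomial by a binomial coefficient; replacing \<open>a # b # \<alpha>\<close> by
  \<open>(a + b) # \<alpha>\<close> lowers the length by one and flips the sign.\<close>

lemma alternating_multinomial_sum_Cons_Cons:
  assumes "0 < a" "0 < b"
  shows "alternating_multinomial_sum (a # b # \<alpha>) =
    int (sum_list (a # b # \<alpha>) choose a) * alternating_multinomial_sum (b # \<alpha>)
    - alternating_multinomial_sum ((a + b) # \<alpha>)"
proof -
  let ?f = "\<lambda>\<beta>. (-1) ^ (length (a # b # \<alpha>) - length \<beta>) * int (multinomial \<beta>)"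
  have "sum ?f ((#) a ` {\<beta>. \<beta> \<preceq>\<^sub>c b # \<alpha>}) =
      (\<Sum>\<beta> | \<beta> \<preceq>\<^sub>c b # \<alpha>. int (sum_list (a # b # \<alpha>) choose a) *
        ((-1) ^ (length (b # \<alpha>) - length \<beta>) * int (multinomial \<beta>)))"
    by (subst sum.reindex) (auto simp: multinomial_Cons coarser_iff intro!: sum.cong)
  moreover have "sum ?f {\<beta>. \<beta> \<preceq>\<^sub>c (a + b) # \<alpha>} =
      (\<Sum>\<beta> | \<beta> \<preceq>\<^sub>c (a + b) # \<alpha>.
        - ((-1) ^ (length ((a + b) # \<alpha>) - length \<beta>) * int (multinomial \<beta>)))"
    using length_le_coarser by (intro sum.cong) (force simp: Suc_diff_le)+
  ultimately show ?thesis
    unfolding alternating_multinomial_sum_def coarser_Cons_Cons(1)[OF assms]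
    by (subst sum.union_disjoint)
      (use coarser_Cons_Cons(2)[OF assms] in \<open>simp_all add: finite_coarser sum_distrib_left sum_negf\<close>)
qed

section \<open>Sizes of hypoplactic classes\<close>

text \<open>Induction on the number of rows, since \<open>(r @ s) # S\<close> has fewer rows than
  \<open>r # s # S\<close> without being a sublist of it. Both sides then obey the same
  recursion.\<close>

lemma card_compatible:
  "row_ordered T \<Longrightarrow> int (card {w. compatible w T}) = alternating_multinomial_sum (shape T)"
proof (induction "length T" arbitrary: T)
  case 0
  then show ?case
    by (simp add: compatible_def alternating_multinomial_sum_def shape_def coarser_Nil multinomial_def)
next
  case (Suc m)
  show ?case
  proof (cases "m = 0")
    case True
    with Suc obtain r where "T = [r]"
      by (metis length_0_conv length_Suc_conv)
    with Suc.prems show ?thesis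
      by (simp add: compatible_single alternating_multinomial_sum_def shape_def coarser_single
          multinomial_def row_ordered_Cons)
  next
    case False
    with Suc obtain r s S where T: "T = r # s # S"
      by (metis length_0_conv length_Suc_conv list.exhaust)
    have "row_ordered (s # S)" "row_ordered ((r @ s) # S)" "0 < length r" "0 < length s"
      using Suc.prems row_ordered_merge[of r s S] by (auto simp: T row_ordered_Cons)
    then show ?thesis
      using arg_cong[OF card_compatible_merge[of r s S], of int] Suc
        alternating_multinomial_sum_Cons_Cons[of "length r" "length s" "shape S"]
      by (simp add: T shape_def)
  qed
qed

theorem theorem8p2:
  fixes n :: nat and \<alpha> :: "nat list"
  assumes "composition \<alpha>"
  shows
    "let N = (if length \<alpha> \<le> n
              then \<Sum>\<beta> | \<beta> \<preceq>\<^sub>c \<alpha>. (-1) ^ (length \<alpha> - length \<beta>) * int (multinomial \<beta>)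
              else 0)
     in (\<forall>w \<in> lists {1..n}. shape (QR w) = \<alpha> \<longrightarrow>
           finite (hypoplactic_class n w) \<and> int (card (hypoplactic_class n w)) = N) \<and>
        (\<forall>T. quasi_ribbon_tableau T \<and> shape T = \<alpha> \<and> (length \<alpha> \<le> n \<longrightarrow> entries T \<subseteq> {1..n}) \<longrightarrow>
           finite {w \<in> lists {1..n}. QR w = T} \<and>
           int (card {w \<in> lists {1..n}. QR w = T}) = N)"
proof -
  have QR_set: "set w = entries (QR w)" for w
    by (rule compatible_set[OF compatible_QR])
  \<comment> \<open>Serves both claims: the first one is the case \<open>T = QR w\<close>.\<close>
  have count: "finite {w \<in> lists {1..n}. QR w = T} \<and>
      int (card {w \<in> lists {1..n}. QR w = T}) =
        (if length (shape T) \<le> n then alternating_multinomial_sum (shape T) else 0)"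
    if T: "row_ordered T" and n: "length (shape T) \<le> n \<longrightarrow> entries T \<subseteq> {1..n}" for T
  proof (cases "length (shape T) \<le> n")
    case True
    \<comment> \<open>A word compatible with \<open>T\<close> uses exactly the entries of
      \<open>T\<close>, so it lies over the alphabet automatically.\<close>
    then have "{w \<in> lists {1..n}. QR w = T} = {w. compatible w T}"
      using n by (auto simp: lists_eq_set QR_eq_iff[OF T] dest: compatible_set)
    then show ?thesis
      using True card_compatible[OF T] finite_compatible by simp
  next
    case False
    \<comment> \<open>\<open>T\<close> has at least as many distinct entries as rows, and these are
      letters of \<open>w\<close>.\<close>
    have "length (shape T) \<le> n" if "set w \<subseteq> {1..n}" "QR w = T" for w
      using length_le_card_entries[OF T] card_mono[OF _ that(1)] QR_set[of w] that(2)
      by (simp add: shape_def)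
    then have "{w \<in> lists {1..n}. QR w = T} = {}"
      using False by (auto simp: lists_eq_set)
    then show ?thesis
      using False by (simp only: card.empty finite.emptyI) simp
  qed
  have "hypoplactic_class n w = {u \<in> lists {1..n}. QR u = QR w}" for w
    by (simp add: hypoplactic_class_def)
  moreover have "entries (QR w) \<subseteq> {1..n}" if "w \<in> lists {1..n}" for w
    using that QR_set[of w] by (auto simp: lists_eq_set)
  ultimately show ?thesis
    using count row_ordered_QR row_ordered_quasi_ribbon_tableau
    by (simp add: Let_def alternating_multinomial_sum_def)
qed

end
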